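(* Let $\alpha=(\alpha_n)_{n\in\mathbb{N}}$ be a non-negative increasing sequence with $\lim_{n\to\infty}\alpha_n=\infty$. Assume that $\alpha$ is stable and that $\Lambda_1(\alpha)$ is nuclear, and let $\beta\in(\Lambda_1(\alpha))'$. Then the dual convolution operator $\check{T}_\beta:\Lambda_1(\alpha)\to\Lambda_1(\alpha)$ is topologizable if and only if for every $p\in\mathbb{N}$ there exists $q\in\mathbb{N}$ such that for every $k\in\mathbb{N}$ there is $L_{k,p}>0$ with $$|\beta^{*k}_{n-1}|\le L_{k,p}\,e^{-\frac1q\alpha_n}\quad\text{for every } n\in\mathbb{N}.$$
   Context: $\mathbb{N}=\{1,2,\dots\}$, $\mathbb{N}_0=\mathbb{N}\cup\{0\}$. The sequence $\alpha$ is stable if $\sup_{n\in\mathbb{N}}\alpha_{2n}/\alpha_n<\infty$. The power series space of finite type is $\Lambda_1(\alpha)=\{x=(x_n)_{n\in\mathbb{N}}:\|x\|_k:=\sum_{n=1}^\infty|x_n|e^{-\frac1k\alpha_n}<\infty\text{ for all }k\in\mathbb{N}\}$, a Fréchet space with the increasing sequence of seminorms $(\|\cdot\|_k)_{k\in\mathbb{N}}$ and canonical basis $(e_n)_{n\in\mathbb{N}}$. It is nuclear if and only if $\lim_{n\to\infty}\frac{\ln n}{\alpha_n}=0$. Its dual is identified with the sequences $\beta=(\beta_n)_{n\in\mathbb{N}_0}$ (indexed from $0$, $\beta_{n-1}$ being the $n$-th coordinate) such that for some $m\in\mathbb{N}$, $C>0$: $|\beta_{n-1}|\le Ce^{-\frac1m\alpha_n}$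 for all $n\in\mathbb{N}$. The dual convolution operator $\check{T}_\beta$ is the continuous linear operator on $\Lambda_1(\alpha)$ with $\check{T}_\beta e_n=\sum_{j=1}^n\beta_{n-j}e_j$ and $\check{T}_\beta x=\sum_{n=1}^\infty x_n\check{T}_\beta e_n$ (well-defined and continuous for every $\beta\in(\Lambda_1(\alpha))'$ when $\alpha$ is stable and $\Lambda_1(\alpha)$ is nuclear). Convolution of sequences indexed by $\mathbb{N}_0$: $(\beta*\psi)_m=\sum_{i=0}^m\beta_i\psi_{m-i}$; $\beta^{*k}=\beta*\cdots*\beta$ ($k$ factors), and $\beta^{*k}_{m}$ is its entry of index $m\in\mathbb{N}_0$. A continuous linear operator $T$ on a Fréchet space $E$ with increasing seminorms $(\|\cdot\|_p)_{p\in\mathbb{N}}$ is topologizable if for every $p\in\mathbb{N}$ there is $q\in\mathbb{N}$ such that for every $k\in\mathbb{N}$ there is $M_{k,p}>0$ with $\|T^kx\|_p\le M_{k,p}\|x\|_q$ for all $x\in E$. *)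

theory Defs
  imports "HOL-Analysis.Analysis"
begin

text \<open>
  The scalars are an arbitrary type of sort \<open>{real_normed_field, banach}\<close>, whose only instances up to
  isomorphism are the real and the complex numbers. Sequences indexed by \<open>{1, 2, \<dots>}\<close> are functions on
  \<open>nat\<close>; the weight \<open>\<alpha>\<close> is only ever evaluated at positive indices, and elements of the power series
  space are pinned to \<open>0\<close> at index \<open>0\<close>, so that they correspond bijectively to the sequences
  indexed by \<open>{1, 2, \<dots>}\<close>.
\<close>

section \<open>Sequence spaces with a sequence of seminorms\<close>

text \<open>
  In this section \<open>E\<close> is a linear space of sequences (with pointwise operations) and
  \<open>\<nu> p\<close> for \<open>p \<ge> 1\<close> are the increasing seminorms defining its topology.
\<close>

definition linear_functional_on ::
    "(nat \<Rightarrow> 'a::real_normed_field) set \<Rightarrow> ((nat \<Rightarrow> 'a) \<Rightarrow> 'a) \<Rightarrow> bool" where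
  "linear_functional_on E \<phi> \<longleftrightarrow>
     (\<forall>x\<in>E. \<forall>y\<in>E. \<phi> (\<lambda>n. x n + y n) = \<phi> x + \<phi> y) \<and>
     (\<forall>c. \<forall>x\<in>E. \<phi> (\<lambda>n. c * x n) = c * \<phi> x)"

definition continuous_linear_operator ::
    "(nat \<Rightarrow> 'a::real_normed_field) set \<Rightarrow> (nat \<Rightarrow> (nat \<Rightarrow> 'a) \<Rightarrow> real) \<Rightarrow>
      ((nat \<Rightarrow> 'a) \<Rightarrow> (nat \<Rightarrow> 'a)) \<Rightarrow> bool" where
  "continuous_linear_operator E \<nu> T \<longleftrightarrow>
     (\<forall>x\<in>E. T x \<in> E) \<and>
     (\<forall>x\<in>E. \<forall>y\<in>E. T (\<lambda>n. x n + y n) = (\<lambda>n. T x n + T y n)) \<and>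
     (\<forall>c. \<forall>x\<in>E. T (\<lambda>n. c * x n) = (\<lambda>n. c * T x n)) \<and>
     (\<forall>p\<ge>1. \<exists>q\<ge>1. \<exists>C>0. \<forall>x\<in>E. \<nu> p (T x) \<le> C * \<nu> q x)"

definition topologizable ::
    "(nat \<Rightarrow> 'a::real_normed_field) set \<Rightarrow> (nat \<Rightarrow> (nat \<Rightarrow> 'a) \<Rightarrow> real) \<Rightarrow>
      ((nat \<Rightarrow> 'a) \<Rightarrow> (nat \<Rightarrow> 'a)) \<Rightarrow> bool" where
  "topologizable E \<nu> T \<longleftrightarrow>
     continuous_linear_operator E \<nu> T \<and>
     (\<forall>p\<ge>1. \<exists>q\<ge>1. \<forall>k\<ge>1. \<exists>M>0. \<forall>x\<in>E. \<nu> p ((T ^^ k) x) \<le> M * \<nu> q x)"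

text \<open>
  Grothendieck's definition: for every \<open>p\<close> there is \<open>q\<close> such that the canonical map between the local
  Banach spaces of \<open>\<nu> q\<close> and \<open>\<nu> p\<close> is nuclear, i.e. of the form \<open>x \<mapsto> \<Sum>j. \<phi> j x \<cdot> y j\<close> with
  \<open>\<Sum>j. \<parallel>\<phi> j\<parallel> \<cdot> \<parallel>y j\<parallel> < \<infinity>\<close>. The vectors \<open>y j\<close> may be taken in \<open>E\<close> instead of in the completion
  with respect to \<open>\<nu> p\<close>: every element \<open>y\<close> of the completion is an absolutely convergent series of
  elements of \<open>E\<close> whose sum of norms is at most \<open>2 \<parallel>y\<parallel>\<close>. For the same reason of density the identity
  need only be required on \<open>E\<close>.
\<close>

definition nuclear_space ::
    "(nat \<Rightarrow> 'a::real_normed_field) set \<Rightarrow> (nat \<Rightarrow> (nat \<Rightarrow> 'a) \<Rightarrow> real) \<Rightarrow> bool" where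
  "nuclear_space E \<nu> \<longleftrightarrow>
     (\<forall>p\<ge>1. \<exists>q\<ge>1. \<exists>\<phi> a y.
        (\<forall>j::nat. linear_functional_on E (\<phi> j) \<and> a j \<ge> 0 \<and>
           (\<forall>x\<in>E. norm (\<phi> j x) \<le> a j * \<nu> q x) \<and> y j \<in> E) \<and>
        summable (\<lambda>j. a j * \<nu> p (y j)) \<and>
        (\<forall>x\<in>E. (\<lambda>N. \<nu> p (\<lambda>n. x n - (\<Sum>j<N. \<phi> j x * y j n))) \<longlonglongrightarrow> 0))"

section \<open>Power series spaces of finite type\<close>

text \<open>
  Since \<open>t / 0 = 0\<close>, indices with \<open>\<alpha> n = 0\<close> impose no condition here; for a sequence tending to
  infinity there are only finitely many of them.
\<close>

definition stable_seq :: "(nat \<Rightarrow> real) \<Rightarrow> bool" where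
  "stable_seq \<alpha> \<longleftrightarrow> bdd_above ((\<lambda>n. \<alpha> (2 * n) / \<alpha> n) ` {1..})"

definition Lambda1 :: "(nat \<Rightarrow> real) \<Rightarrow> (nat \<Rightarrow> 'a::real_normed_field) set" where
  "Lambda1 \<alpha> = {x. x 0 = 0 \<and>
     (\<forall>k\<ge>1. summable (\<lambda>n. norm (x (Suc n)) * exp (- (1 / real k) * \<alpha> (Suc n))))}"

definition Lambda1_norm :: "(nat \<Rightarrow> real) \<Rightarrow> nat \<Rightarrow> (nat \<Rightarrow> 'a::real_normed_field) \<Rightarrow> real" where
  "Lambda1_norm \<alpha> k x = (\<Sum>n. norm (x (Suc n)) * exp (- (1 / real k) * \<alpha> (Suc n)))"

text \<open>The dual consists of sequences indexed from \<open>0\<close>.\<close>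

definition Lambda1_dual :: "(nat \<Rightarrow> real) \<Rightarrow> (nat \<Rightarrow> 'a::real_normed_field) set" where
  "Lambda1_dual \<alpha> = {\<beta>. \<exists>m\<ge>1. \<exists>C>0. \<forall>n\<ge>1.
     norm (\<beta> (n - 1)) \<le> C * exp (- (1 / real m) * \<alpha> n)}"

section \<open>Dual convolution operators\<close>

definition unit_seq :: "nat \<Rightarrow> nat \<Rightarrow> 'a::real_normed_field" where
  "unit_seq n = (\<lambda>i. if i = n then 1 else 0)"

definition dual_conv_unit :: "(nat \<Rightarrow> 'a::real_normed_field) \<Rightarrow> nat \<Rightarrow> nat \<Rightarrow> 'a" where
  "dual_conv_unit \<beta> n = (\<lambda>i. \<Sum>j=1..n. \<beta> (n - j) * unit_seq j i)"

text \<open>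
  The series \<open>\<Sum>n\<ge>1. x n \<cdot> dual_conv_unit \<beta> n\<close>, evaluated coordinatewise; coordinates are continuous
  on the power series space, so this is its sum there whenever it converges there.
\<close>

definition dual_conv :: "(nat \<Rightarrow> 'a::{real_normed_field,banach}) \<Rightarrow> (nat \<Rightarrow> 'a) \<Rightarrow> nat \<Rightarrow> 'a" where
  "dual_conv \<beta> x = (\<lambda>i. \<Sum>n. x (Suc n) * dual_conv_unit \<beta> (Suc n) i)"

definition conv :: "(nat \<Rightarrow> 'a::real_normed_field) \<Rightarrow> (nat \<Rightarrow> 'a) \<Rightarrow> nat \<Rightarrow> 'a" where
  "conv \<beta> \<psi> m = (\<Sum>i\<le>m. \<beta> i * \<psi> (m - i))"

text \<open>The empty convolution product is the neutral element \<open>unit_seq 0\<close>.\<close>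

primrec conv_pow :: "(nat \<Rightarrow> 'a::real_normed_field) \<Rightarrow> nat \<Rightarrow> nat \<Rightarrow> 'a" where
  "conv_pow \<beta> 0 = unit_seq 0"
| "conv_pow \<beta> (Suc k) = conv \<beta> (conv_pow \<beta> k)"

end

theory Submission
  imports Defs
begin

text \<open>
  Write \<open>w\<^sub>p n = exp (- \<alpha>\<^bsub>n+1\<^esub> / p)\<close>. In these terms \<open>\<nu> p x = \<Sum>n. norm (x\<^bsub>n+1\<^esub>) * w\<^sub>p n\<close>,
  the \<open>p\<close>-th seminorm of the unit vector \<open>e\<^bsub>n+1\<^esub>\<close> is \<open>w\<^sub>p n\<close>, and \<open>\<gamma>\<close> is in the dual iff
  \<open>norm (\<gamma> n) \<le> C * w\<^sub>m n\<close> for some \<open>m\<close> and \<open>C\<close>.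

  Everything rests on one estimate, \<open>weight_conv_estimate\<close>: for all \<open>p\<close> and \<open>q\<close> there are \<open>r\<close> and
  \<open>C\<close> with \<open>w\<^sub>p * w\<^sub>q \<le> C * w\<^sub>r\<close> (a convolution on the left). In the sum over \<open>i \<le> n\<close>, one of the
  indices \<open>i\<close> and \<open>n - i\<close> is at least \<open>n / 2\<close>, so stability bounds each summand by a constant times
  some \<open>w\<^sub>s n\<close>; there are \<open>n + 1\<close> summands, and nuclearity allows half of the exponent to
  absorb this factor. Nuclearity enters through \<open>sum_weight_bounded\<close>, the easy half of the
  Grothendieck--Pietsch criterion.

  The estimate gives three facts. The dual is closed under convolution. If
  \<open>norm (\<gamma> n) \<le> L * w\<^sub>q n\<close>, then the operator with symbol \<open>\<gamma>\<close> satisfies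
  \<open>\<nu> p (T x) \<le> L * C * \<nu> r x\<close> with \<open>r\<close> and \<open>C\<close> determined by \<open>p\<close> and \<open>q\<close> alone
  (\<open>dual_conv_bounded\<close>). Finally, composing two such operators convolves their symbols, so the
  \<open>k\<close>-th power of the operator has the symbol \<open>\<beta>\<^sup>*\<^sup>k\<close> (\<open>dual_conv_funpow\<close>).

  If the entries of all the powers \<open>\<beta>\<^sup>*\<^sup>k\<close> decay at one common rate \<open>q\<close>, the second fact, applied to
  these powers as symbols, bounds for each \<open>p\<close> all powers of the operator with one \<open>r\<close>, which is
  topologizability. Conversely,
  the first coordinate of the \<open>k\<close>-th power at the unit vector \<open>e\<^sub>n\<close> is the entry of \<open>\<beta>\<^sup>*\<^sup>k\<close> with index
  \<open>n - 1\<close>, and testing topologizability on \<open>e\<^sub>n\<close> bounds it by a multiple of \<open>\<nu> q e\<^sub>n\<close>.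
\<close>

section \<open>Weights, and the power series space in terms of them\<close>

text \<open>
  The shift by one lets convolutions of weights run over indices from \<open>0\<close>, as those of symbols do.
\<close>

definition weight :: "(nat \<Rightarrow> real) \<Rightarrow> nat \<Rightarrow> nat \<Rightarrow> real" where
  "weight \<alpha> p n = exp (- (1 / real p) * \<alpha> (Suc n))"

lemma weight_pos [simp]: "weight \<alpha> p n > 0"
  by (simp add: weight_def)

lemma weight_nonneg [simp]: "weight \<alpha> p n \<ge> 0"
  by (simp add: weight_def)

lemma weight_neq_0 [simp]: "weight \<alpha> p n \<noteq> 0"
  by (simp add: weight_def)

lemma Lambda1_iff:
  "x \<in> Lambda1 \<alpha> \<longleftrightarrow> x 0 = 0 \<and> (\<forall>p\<ge>1. summable (\<lambda>n. norm (x (Suc n)) * weight \<alpha> p n))"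
  by (simp add: Lambda1_def weight_def)

lemma Lambda1_norm_eq: "Lambda1_norm \<alpha> p x = (\<Sum>n. norm (x (Suc n)) * weight \<alpha> p n)"
  by (simp add: Lambda1_norm_def weight_def)

lemma Lambda1_summable:
  "x \<in> Lambda1 \<alpha> \<Longrightarrow> p \<ge> 1 \<Longrightarrow> summable (\<lambda>n. norm (x (Suc n)) * weight \<alpha> p n)"
  by (simp add: Lambda1_iff)

lemma all_pos_nat_iff: "(\<forall>n\<ge>1. P n) \<longleftrightarrow> (\<forall>n. P (Suc n))"
  by (metis One_nat_def Suc_le_D le_add1 plus_1_eq_Suc)

lemma Lambda1_dual_iff:
  "\<beta> \<in> Lambda1_dual \<alpha> \<longleftrightarrow> (\<exists>m\<ge>1. \<exists>C>0. \<forall>n. norm (\<beta> n) \<le> C * weight \<alpha> m n)"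
  unfolding Lambda1_dual_def mem_Collect_eq by (subst all_pos_nat_iff) (simp add: weight_def)

lemma coordinate_le_Lambda1_norm:
  assumes "x \<in> Lambda1 \<alpha>" "p \<ge> 1"
  shows "norm (x (Suc n)) * weight \<alpha> p n \<le> Lambda1_norm \<alpha> p x"
  using sum_le_suminf[OF Lambda1_summable[OF assms], of "{n}"]
  by (simp add: Lambda1_norm_eq)

lemma sum_coordinates_le_Lambda1_norm:
  assumes "x \<in> Lambda1 \<alpha>" "p \<ge> 1"
  shows "(\<Sum>n<N. norm (x (Suc n)) * weight \<alpha> p n) \<le> Lambda1_norm \<alpha> p x"
  unfolding Lambda1_norm_eq by (rule sum_le_suminf[OF Lambda1_summable[OF assms]]) auto

lemma Lambda1_add:
  assumes "x \<in> Lambda1 \<alpha>" "y \<in> Lambda1 \<alpha>"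
  shows "(\<lambda>n. x n + y n) \<in> Lambda1 \<alpha>"
proof -
  have "summable (\<lambda>n. norm (x (Suc n) + y (Suc n)) * weight \<alpha> p n)" if p: "p \<ge> 1" for p
  proof (rule summable_comparison_test')
    show "summable (\<lambda>n. norm (x (Suc n)) * weight \<alpha> p n + norm (y (Suc n)) * weight \<alpha> p n)"
      using assms p by (intro summable_add Lambda1_summable)
    show "norm (norm (x (Suc n) + y (Suc n)) * weight \<alpha> p n)
        \<le> norm (x (Suc n)) * weight \<alpha> p n + norm (y (Suc n)) * weight \<alpha> p n" for n
      by (simp add: norm_triangle_ineq flip: distrib_right)
  qed
  then show ?thesis
    using assms by (simp add: Lambda1_iff)
qed

lemma Lambda1_scale:
  assumes "x \<in> Lambda1 \<alpha>"
  shows "(\<lambda>n. c * x n) \<in> Lambda1 \<alpha>"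
  using assms by (auto simp: Lambda1_iff norm_mult mult.assoc intro: summable_mult)

lemma Lambda1_sum:
  assumes "finite A" "\<And>j. j \<in> A \<Longrightarrow> x j \<in> Lambda1 \<alpha>"
  shows "(\<lambda>n. \<Sum>j\<in>A. x j n) \<in> Lambda1 \<alpha>"
  using assms
proof (induction A rule: finite_induct)
  case empty
  then show ?case by (simp add: Lambda1_iff)
next
  case (insert a A)
  then show ?case using Lambda1_add[of "x a" \<alpha> "\<lambda>n. \<Sum>j\<in>A. x j n"] by simp
qed

lemma Lambda1_diff:
  assumes "x \<in> Lambda1 \<alpha>" "y \<in> Lambda1 \<alpha>"
  shows "(\<lambda>n. x n - y n) \<in> Lambda1 \<alpha>"
  using Lambda1_add[OF assms(1) Lambda1_scale[OF assms(2), of "-1"]] by simp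

lemma unit_seq_in_Lambda1: "(unit_seq (Suc n) :: nat \<Rightarrow> 'a::real_normed_field) \<in> Lambda1 \<alpha>"
proof -
  have "summable (\<lambda>i. norm (unit_seq (Suc n) (Suc i) :: 'a) * weight \<alpha> p i)" for p
    by (rule summable_finite[of "{n}"]) (auto simp: unit_seq_def)
  then show ?thesis by (simp add: Lambda1_iff unit_seq_def[of "Suc n"])
qed

lemma Lambda1_norm_unit_seq:
  "Lambda1_norm \<alpha> p (unit_seq (Suc n) :: nat \<Rightarrow> 'a::real_normed_field) = weight \<alpha> p n"
  unfolding Lambda1_norm_eq by (subst suminf_finite[of "{n}"]) (auto simp: unit_seq_def)

section \<open>The convolution estimate for weights\<close>

text \<open>
  The trace argument behind the Grothendieck--Pietsch criterion. Take a nuclear representation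
  \<open>x = \<Sum>j. \<phi> j x \<cdot> y j\<close> in the seminorm \<open>p\<close> and read off the coordinate \<open>Suc n\<close> of the unit vector
  with that index: the value \<open>1\<close> is at most \<open>\<Sum>j. a j * norm (y j (Suc n))\<close>, because \<open>\<nu> q\<close> is at most
  \<open>1\<close> on unit vectors. Multiplying by the weight and summing over \<open>n\<close> produces the norms of
  the \<open>y j\<close>.
\<close>

lemma sum_weight_bounded:
  fixes \<alpha> :: "nat \<Rightarrow> real"
  assumes nonneg: "\<And>n. n \<ge> 1 \<Longrightarrow> \<alpha> n \<ge> 0"
    and nuc: "nuclear_space (Lambda1 \<alpha> :: (nat \<Rightarrow> 'a::real_normed_field) set) (Lambda1_norm \<alpha>)"
    and p: "p \<ge> 1"
  shows "\<exists>B. \<forall>N. (\<Sum>n<N. weight \<alpha> p n) \<le> B"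
proof -
  obtain q \<phi> a and y :: "nat \<Rightarrow> nat \<Rightarrow> 'a" where q: "q \<ge> 1"
    and rep: "\<forall>j. linear_functional_on (Lambda1 \<alpha>) (\<phi> j) \<and> a j \<ge> 0 \<and>
      (\<forall>x\<in>Lambda1 \<alpha>. norm (\<phi> j x) \<le> a j * Lambda1_norm \<alpha> q x) \<and> y j \<in> Lambda1 \<alpha>"
    and sm: "summable (\<lambda>j. a j * Lambda1_norm \<alpha> p (y j))"
    and conv: "\<forall>x\<in>Lambda1 \<alpha>.
      (\<lambda>N. Lambda1_norm \<alpha> p (\<lambda>n. x n - (\<Sum>j<N. \<phi> j x * y j n))) \<longlonglongrightarrow> 0"
    using nuc[unfolded nuclear_space_def, rule_format, OF p] by (elim exE conjE)
  have a: "a j \<ge> 0" and y: "y j \<in> Lambda1 \<alpha>"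
    and \<phi>: "x \<in> Lambda1 \<alpha> \<Longrightarrow> norm (\<phi> j x) \<le> a j * Lambda1_norm \<alpha> q x" for j x
    using rep by simp_all
  have lim: "(\<lambda>N. Lambda1_norm \<alpha> p (\<lambda>n. x n - (\<Sum>j<N. \<phi> j x * y j n))) \<longlonglongrightarrow> 0"
    if "x \<in> Lambda1 \<alpha>" for x
    using conv that by (rule bspec)
  have le: "a j * (norm (y j (Suc n)) * weight \<alpha> p n) \<le> a j * Lambda1_norm \<alpha> p (y j)" for j n
    using coordinate_le_Lambda1_norm[OF y p] a by (intro mult_left_mono)
  have sm': "summable (\<lambda>j. a j * (norm (y j (Suc n)) * weight \<alpha> p n))" for n
    using le a by (intro summable_comparison_test'[OF sm]) auto
  have weight_le: "weight \<alpha> p n \<le> (\<Sum>j. a j * (norm (y j (Suc n)) * weight \<alpha> p n))"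
    (is "_ \<le> ?Y") for n
  proof -
    let ?e = "unit_seq (Suc n) :: nat \<Rightarrow> 'a"
    let ?S = "\<lambda>N. \<Sum>j<N. \<phi> j ?e * y j (Suc n)"
    have "norm (1 - ?S N) * weight \<alpha> p n
        \<le> Lambda1_norm \<alpha> p (\<lambda>i. ?e i - (\<Sum>j<N. \<phi> j ?e * y j i))" for N
      using coordinate_le_Lambda1_norm[OF Lambda1_diff[OF unit_seq_in_Lambda1 Lambda1_sum] p,
          of "{..<N}" "\<lambda>j i. \<phi> j ?e * y j i" \<alpha> n n]
      by (simp add: unit_seq_def Lambda1_scale y)
    then have to_0: "(\<lambda>N. norm (1 - ?S N) * weight \<alpha> p n) \<longlonglongrightarrow> 0"
      by (intro tendsto_sandwich[OF _ _ tendsto_const lim[OF unit_seq_in_Lambda1[of n \<alpha>]]]) auto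
    have lower: "weight \<alpha> p n - ?Y \<le> norm (1 - ?S N) * weight \<alpha> p n" for N
    proof -
      have weight_le_1: "weight \<alpha> q n \<le> 1"
        using nonneg[of "Suc n"] by (simp add: weight_def)
      have "norm (\<phi> j ?e) \<le> a j" for j
        using \<phi>[OF unit_seq_in_Lambda1, of j n] a[of j] weight_le_1
        by (simp add: Lambda1_norm_unit_seq) (meson mult_left_le order_trans)
      then have "norm (?S N) * weight \<alpha> p n
          \<le> (\<Sum>j<N. a j * norm (y j (Suc n))) * weight \<alpha> p n"
        by (intro mult_right_mono sum_norm_le) (auto simp: norm_mult mult_right_mono)
      also have "\<dots> = (\<Sum>j<N. a j * (norm (y j (Suc n)) * weight \<alpha> p n))"
        by (simp add: sum_distrib_right mult.assoc)
      also have "\<dots> \<le> ?Y"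
        using a by (intro sum_le_suminf[OF sm']) auto
      finally have "norm (?S N) * weight \<alpha> p n \<le> ?Y" .
      moreover have "(1 - norm (?S N)) * weight \<alpha> p n \<le> norm (1 - ?S N) * weight \<alpha> p n"
        using norm_triangle_ineq2[of 1 "?S N"] by (intro mult_right_mono) auto
      ultimately show ?thesis by (simp add: algebra_simps)
    qed
    have "weight \<alpha> p n - ?Y \<le> 0"
      by (rule LIMSEQ_le_const[OF to_0]) (use lower in blast)
    then show ?thesis by simp
  qed
  have "(\<Sum>n<N. weight \<alpha> p n) \<le> (\<Sum>j. a j * Lambda1_norm \<alpha> p (y j))" for N
  proof -
    have "(\<Sum>n<N. weight \<alpha> p n) \<le> (\<Sum>n<N. \<Sum>j. a j * (norm (y j (Suc n)) * weight \<alpha> p n))"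
      by (intro sum_mono weight_le)
    also have "\<dots> = (\<Sum>j. \<Sum>n<N. a j * (norm (y j (Suc n)) * weight \<alpha> p n))"
      by (rule suminf_sum[symmetric]) (rule sm')
    also have "\<dots> \<le> (\<Sum>j. a j * Lambda1_norm \<alpha> p (y j))"
    proof (rule suminf_le[OF _ _ sm])
      show "(\<Sum>n<N. a j * (norm (y j (Suc n)) * weight \<alpha> p n)) \<le> a j * Lambda1_norm \<alpha> p (y j)" for j
        unfolding sum_distrib_left[symmetric]
        using sum_coordinates_le_Lambda1_norm[OF y p] a by (intro mult_left_mono)
      show "summable (\<lambda>j. \<Sum>n<N. a j * (norm (y j (Suc n)) * weight \<alpha> p n))"
        by (intro summable_sum sm')
    qed
    finally show ?thesis .
  qed
  then show ?thesis by blast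
qed

text \<open>
  This is \<open>ln n / \<alpha>\<^sub>n \<longlonglongrightarrow> 0\<close> without the logarithm: the weights decrease in \<open>n\<close>, so \<open>n + 1\<close> times the
  last of them is at most their sum.
\<close>

lemma linear_times_weight_bounded:
  fixes \<alpha> :: "nat \<Rightarrow> real"
  assumes nonneg: "\<And>n. n \<ge> 1 \<Longrightarrow> \<alpha> n \<ge> 0" and mono: "mono_on {1..} \<alpha>"
    and nuc: "nuclear_space (Lambda1 \<alpha> :: (nat \<Rightarrow> 'a::real_normed_field) set) (Lambda1_norm \<alpha>)"
    and p: "p \<ge> 1"
  shows "\<exists>B>0. \<forall>n. real (Suc n) * weight \<alpha> p n \<le> B"
proof -
  obtain B where B: "\<And>N. (\<Sum>n<N. weight \<alpha> p n) \<le> B"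
    using sum_weight_bounded[OF nonneg nuc p] by blast
  have "real (Suc n) * weight \<alpha> p n \<le> B" for n
  proof -
    have "weight \<alpha> p n \<le> weight \<alpha> p i" if "i < Suc n" for i
      using mono_onD[OF mono, of "Suc i" "Suc n"] that by (simp add: weight_def divide_right_mono)
    then have "real (Suc n) * weight \<alpha> p n \<le> (\<Sum>i<Suc n. weight \<alpha> p i)"
      using sum_bounded_below[of "{..<Suc n}" "weight \<alpha> p n" "weight \<alpha> p"] by simp
    then show ?thesis using B[of "Suc n"] by linarith
  qed
  then show ?thesis by (intro exI[of _ "max B 1"]) (auto simp: le_max_iff_disj)
qed

text \<open>
  The additive constant pays for the finitely many \<open>n\<close> with \<open>\<alpha> n = 0\<close>, about which the quotients
  in \<open>stable_seq\<close> say nothing.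
\<close>

lemma stable_seq_doubling:
  fixes \<alpha> :: "nat \<Rightarrow> real"
  assumes nonneg: "\<And>n. n \<ge> 1 \<Longrightarrow> \<alpha> n \<ge> 0" and mono: "mono_on {1..} \<alpha>"
    and lim: "filterlim \<alpha> at_top sequentially" and stable: "stable_seq \<alpha>"
  shows "\<exists>S::nat. S \<ge> 1 \<and> (\<exists>D\<ge>0. \<forall>n\<ge>1. \<alpha> (2 * n) \<le> real S * \<alpha> n + D)"
proof -
  obtain S0 where S0: "\<And>n. n \<ge> 1 \<Longrightarrow> \<alpha> (2 * n) / \<alpha> n \<le> S0"
    using stable unfolding stable_seq_def bdd_above_def by auto
  obtain S :: nat where "S0 \<le> real S" using real_arch_simple by blast
  then have S: "\<alpha> (2 * n) / \<alpha> n \<le> real (max S 1)" if "n \<ge> 1" for n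
    using S0[OF that] by (simp add: le_max_iff_disj)
  obtain N where N: "\<And>n. n \<ge> N \<Longrightarrow> \<alpha> n > 0"
    using lim by (auto simp: filterlim_at_top_dense eventually_sequentially)
  have "\<alpha> (2 * n) \<le> real (max S 1) * \<alpha> n + \<alpha> (2 * Suc N)" if n: "n \<ge> 1" for n
  proof (cases "n \<ge> N")
    case True
    then have "\<alpha> (2 * n) \<le> real (max S 1) * \<alpha> n"
      using S[OF n] N[OF True] by (simp add: divide_le_eq)
    then show ?thesis using nonneg[of "2 * Suc N"] by simp
  next
    case False
    then have "\<alpha> (2 * n) \<le> \<alpha> (2 * Suc N)"
      using n by (intro mono_onD[OF mono]) auto
    moreover have "0 \<le> real (max S 1) * \<alpha> n"
      using nonneg[OF n] by simp
    ultimately show ?thesis by linarith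
  qed
  then show ?thesis
    using nonneg[of "2 * Suc N"] by (intro exI[of _ "max S 1"] conjI exI[of _ "\<alpha> (2 * Suc N)"]) auto
qed

lemma weight_conv_estimate:
  fixes \<alpha> :: "nat \<Rightarrow> real"
  assumes nonneg: "\<And>n. n \<ge> 1 \<Longrightarrow> \<alpha> n \<ge> 0" and mono: "mono_on {1..} \<alpha>"
    and lim: "filterlim \<alpha> at_top sequentially" and stable: "stable_seq \<alpha>"
    and nuc: "nuclear_space (Lambda1 \<alpha> :: (nat \<Rightarrow> 'a::real_normed_field) set) (Lambda1_norm \<alpha>)"
    and p: "p \<ge> 1" and q: "q \<ge> 1"
  shows "\<exists>r\<ge>1. \<exists>C>0. \<forall>n. (\<Sum>i\<le>n. weight \<alpha> p i * weight \<alpha> q (n - i)) \<le> C * weight \<alpha> r n"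
proof -
  obtain S :: nat and D where S: "S \<ge> 1" and D: "D \<ge> 0"
    and SD: "\<And>n. n \<ge> 1 \<Longrightarrow> \<alpha> (2 * n) \<le> real S * \<alpha> n + D"
    using stable_seq_doubling[OF nonneg mono lim stable] by blast
  define t where "t = max p q"
  have t: "t \<ge> 1" "p \<le> t" "q \<le> t" using p by (auto simp: t_def)
  \<comment> \<open>The weight with parameter \<open>S * t\<close> is the square of the one with parameter \<open>r\<close>; one factor
    absorbs the number of summands.\<close>
  define r where "r = 2 * (S * t)"
  have r: "r \<ge> 1" using S t by (simp add: r_def)
  obtain B where B: "B > 0" "\<And>n. real (Suc n) * weight \<alpha> r n \<le> B"
    using linear_times_weight_bounded[OF nonneg mono nuc r] by blast
  have summand: "weight \<alpha> p i * weight \<alpha> q (n - i) \<le> exp D * weight \<alpha> r n * weight \<alpha> r n"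
    if i: "i \<le> n" for i n
  proof -
    let ?m = "max (Suc i) (Suc (n - i))"
    have nn: "\<alpha> (Suc i) \<ge> 0" "\<alpha> (Suc (n - i)) \<ge> 0" by (auto intro: nonneg)
    have "\<alpha> (Suc n) \<le> \<alpha> (2 * ?m)"
      using i by (intro mono_onD[OF mono]) auto
    also have "\<dots> \<le> real S * \<alpha> ?m + D" by (rule SD) simp
    also have "\<dots> \<le> real S * (\<alpha> (Suc i) + \<alpha> (Suc (n - i))) + D"
      using nn by (intro add_right_mono mult_left_mono) (auto simp: max_def)
    finally have "\<alpha> (Suc n) / (real S * real t)
        \<le> (real S * (\<alpha> (Suc i) + \<alpha> (Suc (n - i))) + D) / (real S * real t)"
      by (rule divide_right_mono) simp
    also have "\<dots> = \<alpha> (Suc i) / real t + \<alpha> (Suc (n - i)) / real t + D / (real S * real t)"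
      using S t by (simp add: field_simps)
    also have "\<dots> \<le> \<alpha> (Suc i) / real p + \<alpha> (Suc (n - i)) / real q + D"
    proof (intro add_mono)
      have "1 * 1 \<le> real S * real t" using S t by (intro mult_mono) auto
      then show "D / (real S * real t) \<le> D"
        using D by (simp add: divide_le_eq mult_left_le mult_le_cancel_left1)
    qed (use nn t p q in \<open>auto intro!: divide_left_mono\<close>)
    finally have "- (\<alpha> (Suc i) / real p) - \<alpha> (Suc (n - i)) / real q
        \<le> D - \<alpha> (Suc n) / (real S * real t)" by simp
    then show ?thesis
      using S t by (simp add: weight_def r_def flip: exp_add)
  qed
  have "(\<Sum>i\<le>n. weight \<alpha> p i * weight \<alpha> q (n - i)) \<le> (exp D * B) * weight \<alpha> r n" for n
  proof -
    have "(\<Sum>i\<le>n. weight \<alpha> p i * weight \<alpha> q (n - i))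
        \<le> real (card {..n}) * (exp D * weight \<alpha> r n * weight \<alpha> r n)"
      using summand by (intro sum_bounded_above) auto
    also have "\<dots> = exp D * (real (Suc n) * weight \<alpha> r n) * weight \<alpha> r n" by simp
    also have "\<dots> \<le> exp D * B * weight \<alpha> r n"
      using B by (intro mult_right_mono mult_left_mono) auto
    finally show ?thesis .
  qed
  then show ?thesis using r B(1) by (intro exI[of _ r] conjI exI[of _ "exp D * B"]) auto
qed

section \<open>The dual convolution operator as an upper triangular matrix\<close>

definition conv_matrix :: "(nat \<Rightarrow> 'a::zero) \<Rightarrow> nat \<Rightarrow> nat \<Rightarrow> 'a" where
  "conv_matrix \<gamma> i n = (if i \<le> n then \<gamma> (n - i) else 0)"

lemma dual_conv_0: "dual_conv \<gamma> x 0 = 0"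
proof -
  have "dual_conv_unit \<gamma> n 0 = 0" for n
    unfolding dual_conv_unit_def unit_seq_def by (intro sum.neutral) auto
  then show ?thesis by (simp add: dual_conv_def)
qed

lemma dual_conv_Suc: "dual_conv \<gamma> x (Suc i) = (\<Sum>n. x (Suc n) * conv_matrix \<gamma> i n)"
proof -
  have "dual_conv_unit \<gamma> (Suc n) (Suc i) = conv_matrix \<gamma> i n" for n
  proof -
    have "dual_conv_unit \<gamma> (Suc n) (Suc i)
        = (\<Sum>j=1..Suc n. if j = Suc i then \<gamma> (Suc n - j) else 0)"
      unfolding dual_conv_unit_def unit_seq_def by (intro sum.cong) auto
    also have "\<dots> = conv_matrix \<gamma> i n"
      by (subst sum.delta) (auto simp: conv_matrix_def)
    finally show ?thesis .
  qed
  then show ?thesis by (simp add: dual_conv_def)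
qed

lemma dual_conv_unit_seq:
  assumes "x 0 = 0"
  shows "dual_conv (unit_seq 0) x = x"
proof
  fix i show "dual_conv (unit_seq 0) x i = x i"
  proof (cases i)
    case 0
    then show ?thesis using assms by (simp add: dual_conv_0)
  next
    case (Suc j)
    have "(\<Sum>n. x (Suc n) * conv_matrix (unit_seq 0) j n) = x (Suc j)"
      by (subst suminf_finite[of "{j}"]) (auto simp: conv_matrix_def unit_seq_def)
    then show ?thesis by (simp add: Suc dual_conv_Suc)
  qed
qed

text \<open>
  The first row of the matrix lists the symbol itself, so first coordinates at unit vectors recover it.
\<close>

lemma dual_conv_apply_unit_seq: "dual_conv \<gamma> (unit_seq (Suc n)) (Suc 0) = \<gamma> n"
  unfolding dual_conv_Suc
  by (subst suminf_finite[of "{n}"]) (auto simp: conv_matrix_def unit_seq_def)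

text \<open>
  These Toeplitz matrices multiply by convolving their symbols; triangularity makes the product a
  finite sum. This is what turns powers of the operator into convolution powers of its symbol.
\<close>

lemma sum_conv_matrix_mult:
  "(\<Sum>n\<le>m. conv_matrix \<gamma> n m * conv_matrix \<beta> i n) = conv_matrix (conv \<beta> \<gamma>) i m"
proof (cases "i \<le> m")
  case True
  have "(\<Sum>n\<le>m. conv_matrix \<gamma> n m * conv_matrix \<beta> i n) = (\<Sum>n\<in>{i..m}. \<gamma> (m - n) * \<beta> (n - i))"
    by (rule sum.mono_neutral_cong_right) (auto simp: conv_matrix_def)
  also have "\<dots> = (\<Sum>d\<le>m - i. \<beta> d * \<gamma> (m - i - d))"
    by (rule sum.reindex_bij_witness[of _ "\<lambda>d. d + i" "\<lambda>n. n - i"]) (use True in auto)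
  finally show ?thesis using True by (simp add: conv_matrix_def conv_def)
next
  case False
  then show ?thesis by (auto simp: conv_matrix_def intro!: sum.neutral)
qed

section \<open>Operators whose symbol lies in the dual\<close>

text \<open>
  The assumption condenses monotonicity, stability and nuclearity into the one inequality from which
  the mapping properties and the algebra of dual convolution operators follow.
\<close>

locale convolution_weight =
  fixes \<alpha> :: "nat \<Rightarrow> real"
  assumes conv_estimate: "\<lbrakk>p \<ge> 1; q \<ge> 1\<rbrakk> \<Longrightarrow>
    \<exists>r\<ge>1. \<exists>C>0. \<forall>n. (\<Sum>i\<le>n. weight \<alpha> p i * weight \<alpha> q (n - i)) \<le> C * weight \<alpha> r n"
begin

lemma conv_in_dual:
  assumes "\<beta> \<in> Lambda1_dual \<alpha>" "\<gamma> \<in> Lambda1_dual \<alpha>"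
  shows "conv \<beta> \<gamma> \<in> Lambda1_dual \<alpha>"
proof -
  obtain p A where p: "p \<ge> 1" and A: "A > 0" "\<And>n. norm (\<beta> n) \<le> A * weight \<alpha> p n"
    using assms(1) by (auto simp: Lambda1_dual_iff)
  obtain q B where q: "q \<ge> 1" and B: "B > 0" "\<And>n. norm (\<gamma> n) \<le> B * weight \<alpha> q n"
    using assms(2) by (auto simp: Lambda1_dual_iff)
  obtain r C where r: "r \<ge> 1" and C: "C > 0"
    "\<And>n. (\<Sum>i\<le>n. weight \<alpha> p i * weight \<alpha> q (n - i)) \<le> C * weight \<alpha> r n"
    using conv_estimate[OF p q] by blast
  have "norm (conv \<beta> \<gamma> n) \<le> (A * B * C) * weight \<alpha> r n" for n
  proof -
    have "norm (conv \<beta> \<gamma> n) \<le> (\<Sum>i\<le>n. (A * weight \<alpha> p i) * (B * weight \<alpha> q (n - i)))"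
      unfolding conv_def
    proof (rule sum_norm_le)
      show "norm (\<beta> i * \<gamma> (n - i)) \<le> A * weight \<alpha> p i * (B * weight \<alpha> q (n - i))" for i
        unfolding norm_mult using A by (intro mult_mono A(2) B(2)) auto
    qed
    also have "\<dots> = A * B * (\<Sum>i\<le>n. weight \<alpha> p i * weight \<alpha> q (n - i))"
      by (simp add: sum_distrib_left algebra_simps)
    also have "\<dots> \<le> A * B * (C * weight \<alpha> r n)"
      using A(1) B(1) by (intro mult_left_mono C(2)) auto
    finally show ?thesis by (simp add: mult.assoc)
  qed
  then show ?thesis
    unfolding Lambda1_dual_iff using r A(1) B(1) C(1)
    by (intro exI[of _ r] conjI exI[of _ "A * B * C"]) auto
qed

lemma conv_pow_in_dual:
  assumes "\<beta> \<in> Lambda1_dual \<alpha>"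
  shows "conv_pow \<beta> k \<in> Lambda1_dual \<alpha>"
proof (induction k)
  case 0
  have "norm (unit_seq 0 n :: 'a) \<le> (1 / weight \<alpha> 1 0) * weight \<alpha> 1 n" for n
    by (auto simp: unit_seq_def)
  then show ?case
    unfolding Lambda1_dual_iff conv_pow.simps
    by (intro exI[of _ 1] conjI exI[of _ "1 / weight \<alpha> 1 0"]) auto
next
  case (Suc k)
  then show ?case using conv_in_dual[OF assms] by simp
qed

text \<open>
  The same convolution of weights, seen from the matrix: its \<open>n\<close>-th column paired with a weight. It
  controls both the norm of \<open>dual_conv \<gamma> x\<close> and the double series of a composition.
\<close>

lemma column_estimate:
  assumes p: "p \<ge> 1" and q: "q \<ge> 1"
  shows "\<exists>r\<ge>1. \<exists>C>0. \<forall>(\<gamma> :: nat \<Rightarrow> 'a::real_normed_field) L. L > 0 \<longrightarrow>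
    (\<forall>n. norm (\<gamma> n) \<le> L * weight \<alpha> q n) \<longrightarrow>
    (\<forall>n N. (\<Sum>i<N. norm (conv_matrix \<gamma> i n) * weight \<alpha> p i) \<le> L * C * weight \<alpha> r n)"
proof -
  obtain r C where r: "r \<ge> 1" and C: "C > 0"
    "\<And>n. (\<Sum>i\<le>n. weight \<alpha> p i * weight \<alpha> q (n - i)) \<le> C * weight \<alpha> r n"
    using conv_estimate[OF p q] by blast
  have "(\<Sum>i<N. norm (conv_matrix \<gamma> i n) * weight \<alpha> p i) \<le> L * C * weight \<alpha> r n"
    if L: "L > 0" and \<gamma>: "\<And>n. norm (\<gamma> n) \<le> L * weight \<alpha> q n" for \<gamma> :: "nat \<Rightarrow> 'a" and L n N
  proof -
    have "(\<Sum>i<N. norm (conv_matrix \<gamma> i n) * weight \<alpha> p i)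
        = (\<Sum>i\<in>{..<N} \<inter> {..n}. norm (\<gamma> (n - i)) * weight \<alpha> p i)"
      by (rule sum.mono_neutral_cong_right) (auto simp: conv_matrix_def)
    also have "\<dots> \<le> (\<Sum>i\<le>n. norm (\<gamma> (n - i)) * weight \<alpha> p i)"
      by (rule sum_mono2) auto
    also have "\<dots> \<le> (\<Sum>i\<le>n. (L * weight \<alpha> q (n - i)) * weight \<alpha> p i)"
      by (intro sum_mono mult_right_mono \<gamma>) auto
    also have "\<dots> = L * (\<Sum>i\<le>n. weight \<alpha> p i * weight \<alpha> q (n - i))"
      by (simp add: sum_distrib_left algebra_simps)
    also have "\<dots> \<le> L * (C * weight \<alpha> r n)"
      using L by (intro mult_left_mono C(2)) auto
    finally show ?thesis by (simp add: mult.assoc)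
  qed
  then show ?thesis using r C(1) by blast
qed

text \<open>
  A single entry is dominated by its column sum, so the column estimate bounds every row. Dividing
  by the weight at \<open>i\<close> is harmless because \<open>i\<close> is fixed.
\<close>

lemma row_decay:
  assumes \<gamma>: "\<gamma> \<in> Lambda1_dual \<alpha>"
  shows "\<exists>r\<ge>1. \<exists>K>0. \<forall>n. norm (conv_matrix \<gamma> i n) \<le> K * weight \<alpha> r n"
proof -
  obtain q L where q: "q \<ge> 1" and L: "L > 0" and \<gamma>L: "\<And>n. norm (\<gamma> n) \<le> L * weight \<alpha> q n"
    using \<gamma> by (auto simp: Lambda1_dual_iff)
  obtain r C where r: "r \<ge> 1" and C: "C > 0"
    and est: "\<And>n N. (\<Sum>i<N. norm (conv_matrix \<gamma> i n) * weight \<alpha> 1 i) \<le> L * C * weight \<alpha> r n"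
    using column_estimate[OF order_refl q, where ?'a = 'a] L \<gamma>L by blast
  have "norm (conv_matrix \<gamma> i n) \<le> L * C / weight \<alpha> 1 i * weight \<alpha> r n" for n
  proof -
    have "norm (conv_matrix \<gamma> i n) * weight \<alpha> 1 i
        \<le> (\<Sum>i<Suc i. norm (conv_matrix \<gamma> i n) * weight \<alpha> 1 i)"
      by simp (intro sum_nonneg; simp)
    also have "\<dots> \<le> L * C * weight \<alpha> r n" by (rule est)
    finally show ?thesis by (simp add: pos_le_divide_eq)
  qed
  then show ?thesis using r L C by (intro exI[of _ r] conjI exI[of _ "L * C / weight \<alpha> 1 i"]) auto
qed

lemma row_summable:
  fixes \<gamma> :: "nat \<Rightarrow> 'a::{real_normed_field,banach}"
  assumes \<gamma>: "\<gamma> \<in> Lambda1_dual \<alpha>" and x: "x \<in> Lambda1 \<alpha>"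
  shows "summable (\<lambda>n. norm (x (Suc n) * conv_matrix \<gamma> i n))"
proof -
  obtain r K where r: "r \<ge> 1" and K: "\<And>n. norm (conv_matrix \<gamma> i n) \<le> K * weight \<alpha> r n"
    using row_decay[OF \<gamma>] by blast
  show ?thesis
  proof (rule summable_comparison_test')
    show "summable (\<lambda>n. K * (norm (x (Suc n)) * weight \<alpha> r n))"
      by (intro summable_mult Lambda1_summable x r)
    fix n
    have "norm (x (Suc n)) * norm (conv_matrix \<gamma> i n) \<le> norm (x (Suc n)) * (K * weight \<alpha> r n)"
      by (intro mult_left_mono K) auto
    then show "norm (norm (x (Suc n) * conv_matrix \<gamma> i n)) \<le> K * (norm (x (Suc n)) * weight \<alpha> r n)"
      by (simp add: norm_mult algebra_simps)
  qed
qed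

lemma dual_conv_add:
  fixes \<gamma> :: "nat \<Rightarrow> 'a::{real_normed_field,banach}"
  assumes \<gamma>: "\<gamma> \<in> Lambda1_dual \<alpha>" and x: "x \<in> Lambda1 \<alpha>" and y: "y \<in> Lambda1 \<alpha>"
  shows "dual_conv \<gamma> (\<lambda>n. x n + y n) = (\<lambda>n. dual_conv \<gamma> x n + dual_conv \<gamma> y n)"
proof
  fix i show "dual_conv \<gamma> (\<lambda>n. x n + y n) i = dual_conv \<gamma> x i + dual_conv \<gamma> y i"
    using summable_norm_cancel[OF row_summable[OF \<gamma> x]] summable_norm_cancel[OF row_summable[OF \<gamma> y]]
    by (cases i) (auto simp: dual_conv_0 dual_conv_Suc distrib_right suminf_add)
qed

lemma dual_conv_scale:
  fixes \<gamma> :: "nat \<Rightarrow> 'a::{real_normed_field,banach}"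
  assumes \<gamma>: "\<gamma> \<in> Lambda1_dual \<alpha>" and x: "x \<in> Lambda1 \<alpha>"
  shows "dual_conv \<gamma> (\<lambda>n. c * x n) = (\<lambda>n. c * dual_conv \<gamma> x n)"
proof
  fix i show "dual_conv \<gamma> (\<lambda>n. c * x n) i = c * dual_conv \<gamma> x i"
    using summable_norm_cancel[OF row_summable[OF \<gamma> x]]
    by (cases i) (auto simp: dual_conv_0 dual_conv_Suc mult.assoc suminf_mult)
qed

text \<open>
  The order of the quantifiers matters: \<open>r\<close> and \<open>C\<close> depend on the decay rate \<open>q\<close> of the symbol, but
  not on the symbol itself, which enters through the factor \<open>L\<close> only.
\<close>

lemma dual_conv_bounded:
  assumes p: "p \<ge> 1" and q: "q \<ge> 1"
  shows "\<exists>r\<ge>1. \<exists>C>0. \<forall>(\<gamma> :: nat \<Rightarrow> 'a::{real_normed_field,banach}) L. L > 0 \<longrightarrow>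
    (\<forall>n. norm (\<gamma> n) \<le> L * weight \<alpha> q n) \<longrightarrow>
    (\<forall>x\<in>Lambda1 \<alpha>. summable (\<lambda>i. norm (dual_conv \<gamma> x (Suc i)) * weight \<alpha> p i) \<and>
       Lambda1_norm \<alpha> p (dual_conv \<gamma> x) \<le> L * C * Lambda1_norm \<alpha> r x)"
proof -
  obtain r C where r: "r \<ge> 1" and C: "C > 0"
    and est: "\<forall>(\<gamma> :: nat \<Rightarrow> 'a) L. L > 0 \<longrightarrow> (\<forall>n. norm (\<gamma> n) \<le> L * weight \<alpha> q n) \<longrightarrow>
      (\<forall>n N. (\<Sum>i<N. norm (conv_matrix \<gamma> i n) * weight \<alpha> p i) \<le> L * C * weight \<alpha> r n)"
    using column_estimate[OF p q] by blast
  have "summable (\<lambda>i. norm (dual_conv \<gamma> x (Suc i)) * weight \<alpha> p i) \<and>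
       Lambda1_norm \<alpha> p (dual_conv \<gamma> x) \<le> L * C * Lambda1_norm \<alpha> r x"
    if L: "L > 0" and \<gamma>L: "\<And>n. norm (\<gamma> n) \<le> L * weight \<alpha> q n" and x: "x \<in> Lambda1 \<alpha>"
    for \<gamma> :: "nat \<Rightarrow> 'a" and L x
  proof -
    have \<gamma>: "\<gamma> \<in> Lambda1_dual \<alpha>" using q L \<gamma>L by (auto simp: Lambda1_dual_iff)
    have col: "(\<Sum>i<N. norm (conv_matrix \<gamma> i n) * weight \<alpha> p i) \<le> L * C * weight \<alpha> r n" for n N
      using est L \<gamma>L by blast
    have partial: "(\<Sum>i<N. norm (dual_conv \<gamma> x (Suc i)) * weight \<alpha> p i)
        \<le> L * C * Lambda1_norm \<alpha> r x" for N
    proof -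
      note sm = row_summable[OF \<gamma> x]
      have "(\<Sum>i<N. norm (dual_conv \<gamma> x (Suc i)) * weight \<alpha> p i)
          \<le> (\<Sum>i<N. \<Sum>n. norm (x (Suc n) * conv_matrix \<gamma> i n) * weight \<alpha> p i)"
        unfolding dual_conv_Suc suminf_mult2[OF sm, symmetric]
        by (intro sum_mono mult_right_mono summable_norm sm) auto
      also have "\<dots> = (\<Sum>n. \<Sum>i<N. norm (x (Suc n) * conv_matrix \<gamma> i n) * weight \<alpha> p i)"
        by (rule suminf_sum[symmetric]) (intro summable_mult2 sm)
      also have "\<dots> \<le> (\<Sum>n. L * C * (norm (x (Suc n)) * weight \<alpha> r n))"
      proof (rule suminf_le)
        fix n
        have "(\<Sum>i<N. norm (x (Suc n) * conv_matrix \<gamma> i n) * weight \<alpha> p i)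
            = norm (x (Suc n)) * (\<Sum>i<N. norm (conv_matrix \<gamma> i n) * weight \<alpha> p i)"
          by (simp add: norm_mult sum_distrib_left mult.assoc)
        also have "\<dots> \<le> norm (x (Suc n)) * (L * C * weight \<alpha> r n)"
          by (intro mult_left_mono col) auto
        finally show "(\<Sum>i<N. norm (x (Suc n) * conv_matrix \<gamma> i n) * weight \<alpha> p i)
            \<le> L * C * (norm (x (Suc n)) * weight \<alpha> r n)"
          by (simp add: algebra_simps)
      qed (intro summable_sum summable_mult2 sm summable_mult Lambda1_summable x r)+
      also have "\<dots> = L * C * Lambda1_norm \<alpha> r x"
        unfolding Lambda1_norm_eq by (intro suminf_mult Lambda1_summable x r)
      finally show ?thesis .
    qed
    have sm: "summable (\<lambda>i. norm (dual_conv \<gamma> x (Suc i)) * weight \<alpha> p i)"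
      by (rule summableI_nonneg_bounded[OF _ partial]) auto
    moreover have "Lambda1_norm \<alpha> p (dual_conv \<gamma> x) \<le> L * C * Lambda1_norm \<alpha> r x"
      unfolding Lambda1_norm_eq[of \<alpha> p] by (rule suminf_le_const[OF sm partial])
    ultimately show ?thesis ..
  qed
  then show ?thesis using r C by blast
qed

lemma dual_conv_in_Lambda1:
  fixes \<gamma> :: "nat \<Rightarrow> 'a::{real_normed_field,banach}"
  assumes \<gamma>: "\<gamma> \<in> Lambda1_dual \<alpha>" and x: "x \<in> Lambda1 \<alpha>"
  shows "dual_conv \<gamma> x \<in> Lambda1 \<alpha>"
proof -
  obtain q L where q: "q \<ge> 1" and L: "L > 0" and \<gamma>L: "\<forall>n. norm (\<gamma> n) \<le> L * weight \<alpha> q n"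
    using \<gamma> by (auto simp: Lambda1_dual_iff)
  have "summable (\<lambda>i. norm (dual_conv \<gamma> x (Suc i)) * weight \<alpha> p i)" if "p \<ge> 1" for p
    using dual_conv_bounded[OF that q, where ?'a = 'a] L \<gamma>L x by blast
  then show ?thesis by (simp add: Lambda1_iff dual_conv_0)
qed

lemma dual_conv_continuous:
  fixes \<beta> :: "nat \<Rightarrow> 'a::{real_normed_field,banach}"
  assumes \<beta>: "\<beta> \<in> Lambda1_dual \<alpha>"
  shows "continuous_linear_operator (Lambda1 \<alpha>) (Lambda1_norm \<alpha>) (dual_conv \<beta>)"
proof -
  obtain q L where q: "q \<ge> 1" and L: "L > 0" and \<beta>L: "\<forall>n. norm (\<beta> n) \<le> L * weight \<alpha> q n"
    using \<beta> by (auto simp: Lambda1_dual_iff)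
  have "\<exists>r\<ge>1. \<exists>C>0. \<forall>x\<in>Lambda1 \<alpha>.
      Lambda1_norm \<alpha> p (dual_conv \<beta> x) \<le> C * Lambda1_norm \<alpha> r x" if p: "p \<ge> 1" for p
  proof -
    obtain r C where "r \<ge> 1" "C > 0"
      "\<forall>x\<in>Lambda1 \<alpha>. Lambda1_norm \<alpha> p (dual_conv \<beta> x) \<le> L * C * Lambda1_norm \<alpha> r x"
      using dual_conv_bounded[OF p q, where ?'a = 'a] L \<beta>L by blast
    then show ?thesis using L by (intro exI[of _ r] conjI exI[of _ "L * C"]) auto
  qed
  then show ?thesis
    using \<beta> by (simp add: continuous_linear_operator_def dual_conv_in_Lambda1 dual_conv_add
        dual_conv_scale)
qed

text \<open>
  Truncating the outer sum at \<open>N\<close> makes the interchange of the two summations trivial. For fixed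
  \<open>m\<close> the truncated matrix products are constant once \<open>N > m\<close>, since the matrices are triangular,
  and the column estimate dominates them uniformly in \<open>N\<close>. Tannery's theorem then lets \<open>N\<close> tend
  to infinity under the sum over \<open>m\<close>, where the limit of the products is \<open>sum_conv_matrix_mult\<close>.
\<close>

lemma dual_conv_compose:
  fixes \<beta> \<gamma> :: "nat \<Rightarrow> 'a::{real_normed_field,banach}"
  assumes \<beta>: "\<beta> \<in> Lambda1_dual \<alpha>" and \<gamma>: "\<gamma> \<in> Lambda1_dual \<alpha>" and x: "x \<in> Lambda1 \<alpha>"
  shows "dual_conv \<beta> (dual_conv \<gamma> x) = dual_conv (conv \<beta> \<gamma>) x"
proof
  fix i0
  show "dual_conv \<beta> (dual_conv \<gamma> x) i0 = dual_conv (conv \<beta> \<gamma>) x i0"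
  proof (cases i0)
    case 0
    then show ?thesis by (simp add: dual_conv_0)
  next
    case (Suc i)
    define g where "g m N = (\<Sum>n<N. conv_matrix \<gamma> n m * conv_matrix \<beta> i n)" for m N
    have outer: "(\<lambda>N. \<Sum>n<N. dual_conv \<gamma> x (Suc n) * conv_matrix \<beta> i n)
        \<longlonglongrightarrow> dual_conv \<beta> (dual_conv \<gamma> x) (Suc i)"
      unfolding dual_conv_Suc[of \<beta>]
      by (intro summable_LIMSEQ summable_norm_cancel[OF row_summable]
          dual_conv_in_Lambda1 \<beta> \<gamma> x)
    have swap: "(\<Sum>n<N. dual_conv \<gamma> x (Suc n) * conv_matrix \<beta> i n) = (\<Sum>m. x (Suc m) * g m N)" for N
    proof -
      note sm = summable_norm_cancel[OF row_summable[OF \<gamma> x]]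
      have "(\<Sum>n<N. dual_conv \<gamma> x (Suc n) * conv_matrix \<beta> i n)
          = (\<Sum>n<N. \<Sum>m. x (Suc m) * conv_matrix \<gamma> n m * conv_matrix \<beta> i n)"
        unfolding dual_conv_Suc by (intro sum.cong refl suminf_mult2 sm)
      also have "\<dots> = (\<Sum>m. \<Sum>n<N. x (Suc m) * conv_matrix \<gamma> n m * conv_matrix \<beta> i n)"
        by (rule suminf_sum[symmetric]) (intro summable_mult2 sm)
      finally show ?thesis by (simp add: g_def sum_distrib_left mult.assoc)
    qed
    have limit: "(\<lambda>N. x (Suc m) * g m N) \<longlonglongrightarrow> x (Suc m) * conv_matrix (conv \<beta> \<gamma>) i m" for m
    proof (rule tendsto_eventually)
      have "g m N = conv_matrix (conv \<beta> \<gamma>) i m" if "N > m" for N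
        unfolding g_def sum_conv_matrix_mult[symmetric]
        by (rule sum.mono_neutral_right) (use that in \<open>auto simp: conv_matrix_def\<close>)
      then show "\<forall>\<^sub>F N in sequentially. x (Suc m) * g m N = x (Suc m) * conv_matrix (conv \<beta> \<gamma>) i m"
        by (intro eventually_mono[OF eventually_gt_at_top[of m]]) simp
    qed
    obtain p K where p: "p \<ge> 1" and K: "K > 0" "\<And>n. norm (conv_matrix \<beta> i n) \<le> K * weight \<alpha> p n"
      using row_decay[OF \<beta>] by blast
    obtain q L where q: "q \<ge> 1" and L: "L > 0" and \<gamma>L: "\<And>n. norm (\<gamma> n) \<le> L * weight \<alpha> q n"
      using \<gamma> by (auto simp: Lambda1_dual_iff)
    obtain r C where r: "r \<ge> 1" and C: "C > 0"
      and col: "\<And>m N. (\<Sum>n<N. norm (conv_matrix \<gamma> n m) * weight \<alpha> p n) \<le> L * C * weight \<alpha> r m"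
      using column_estimate[OF p q, where ?'a = 'a] L \<gamma>L by blast
    have dominated: "norm (x (Suc m) * g m N) \<le> K * L * C * (norm (x (Suc m)) * weight \<alpha> r m)" for m N
    proof -
      have "norm (g m N) \<le> (\<Sum>n<N. norm (conv_matrix \<gamma> n m) * (K * weight \<alpha> p n))"
        unfolding g_def by (intro sum_norm_le) (simp add: norm_mult K mult_left_mono)
      also have "\<dots> = K * (\<Sum>n<N. norm (conv_matrix \<gamma> n m) * weight \<alpha> p n)"
        by (simp add: sum_distrib_left algebra_simps)
      also have "\<dots> \<le> K * (L * C * weight \<alpha> r m)"
        using K(1) by (intro mult_left_mono col) auto
      finally have "norm (x (Suc m)) * norm (g m N) \<le> norm (x (Suc m)) * (K * (L * C * weight \<alpha> r m))"
        by (rule mult_left_mono) simp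
      then show ?thesis by (simp add: norm_mult algebra_simps)
    qed
    have "(\<lambda>N. \<Sum>m. x (Suc m) * g m N) \<longlonglongrightarrow> dual_conv (conv \<beta> \<gamma>) x (Suc i)"
      unfolding dual_conv_Suc[of "conv \<beta> \<gamma>"]
    proof -
      have "\<forall>\<^sub>F (m, N) in sequentially \<times>\<^sub>F sequentially.
          norm (x (Suc m) * g m N) \<le> K * L * C * (norm (x (Suc m)) * weight \<alpha> r m)"
        by (rule always_eventually) (simp add: dominated split_beta)
      from tannerys_theorem[OF limit this summable_mult[OF Lambda1_summable[OF x r]]]
      show "(\<lambda>N. \<Sum>m. x (Suc m) * g m N) \<longlonglongrightarrow> (\<Sum>m. x (Suc m) * conv_matrix (conv \<beta> \<gamma>) i m)"
        by simp
    qed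
    then show ?thesis
      using LIMSEQ_unique[OF outer] by (simp add: swap Suc)
  qed
qed

lemma dual_conv_funpow:
  fixes \<beta> :: "nat \<Rightarrow> 'a::{real_normed_field,banach}"
  assumes \<beta>: "\<beta> \<in> Lambda1_dual \<alpha>" and x: "x \<in> Lambda1 \<alpha>"
  shows "(dual_conv \<beta> ^^ k) x = dual_conv (conv_pow \<beta> k) x"
proof (induction k)
  case 0
  then show ?case using x by (simp add: dual_conv_unit_seq Lambda1_iff)
next
  case (Suc k)
  then show ?case using dual_conv_compose[OF \<beta> conv_pow_in_dual[OF \<beta>] x] by simp
qed

end

section \<open>Topologizability\<close>

theorem theorem5p4:
  fixes \<alpha> :: "nat \<Rightarrow> real"
    and \<beta> :: "nat \<Rightarrow> 'a::{real_normed_field,banach}"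
  assumes "\<And>n. n \<ge> 1 \<Longrightarrow> \<alpha> n \<ge> 0"
    and "mono_on {1..} \<alpha>"
    and "filterlim \<alpha> at_top sequentially"
    and "stable_seq \<alpha>"
    and "nuclear_space (Lambda1 \<alpha> :: (nat \<Rightarrow> 'a) set) (Lambda1_norm \<alpha>)"
    and "\<beta> \<in> Lambda1_dual \<alpha>"
  shows "topologizable (Lambda1 \<alpha>) (Lambda1_norm \<alpha>) (dual_conv \<beta>) \<longleftrightarrow>
    (\<forall>p::nat. p \<ge> 1 \<longrightarrow> (\<exists>q::nat. q \<ge> 1 \<and> (\<forall>k\<ge>1. \<exists>L>0. \<forall>n\<ge>1.
       norm (conv_pow \<beta> k (n - 1)) \<le> L * exp (- (1 / real q) * \<alpha> n))))"
    (is "?top \<longleftrightarrow> _")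
proof -
  interpret convolution_weight \<alpha>
    by unfold_locales (rule weight_conv_estimate[OF assms(1-5)])
  note \<beta> = assms(6)
  have entry_iff: "(\<forall>n\<ge>1. norm (conv_pow \<beta> k (n - 1)) \<le> L * exp (- (1 / real q) * \<alpha> n)) \<longleftrightarrow>
      (\<forall>n. norm (conv_pow \<beta> k n) \<le> L * weight \<alpha> q n)" for k q L
    by (subst all_pos_nat_iff) (simp add: weight_def)
  show ?thesis
    unfolding entry_iff
  proof (intro iffI allI impI)
    fix p :: nat assume ?top and p: "p \<ge> 1"
    then obtain q where q: "q \<ge> 1" and M: "\<And>k. k \<ge> 1 \<Longrightarrow> \<exists>M>0. \<forall>x\<in>Lambda1 \<alpha>.
        Lambda1_norm \<alpha> p ((dual_conv \<beta> ^^ k) x) \<le> M * Lambda1_norm \<alpha> q x"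
      unfolding topologizable_def by blast
    have "\<exists>L>0. \<forall>n. norm (conv_pow \<beta> k n) \<le> L * weight \<alpha> q n" if k: "k \<ge> 1" for k
    proof -
      obtain M where "M > 0" and M: "\<And>x. x \<in> Lambda1 \<alpha> \<Longrightarrow>
          Lambda1_norm \<alpha> p ((dual_conv \<beta> ^^ k) x) \<le> M * Lambda1_norm \<alpha> q x"
        using M[OF k] by blast
      have "norm (conv_pow \<beta> k n) \<le> M / weight \<alpha> p 0 * weight \<alpha> q n" for n
      proof -
        let ?e = "unit_seq (Suc n) :: nat \<Rightarrow> 'a"
        have e: "?e \<in> Lambda1 \<alpha>" by (rule unit_seq_in_Lambda1)
        have "norm (conv_pow \<beta> k n) * weight \<alpha> p 0
            \<le> Lambda1_norm \<alpha> p (dual_conv (conv_pow \<beta> k) ?e)"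
          using coordinate_le_Lambda1_norm[OF dual_conv_in_Lambda1[OF conv_pow_in_dual[OF \<beta>] e] p, of k 0]
          by (simp add: dual_conv_apply_unit_seq)
        also have "\<dots> \<le> M * weight \<alpha> q n"
          using M[OF e] by (simp add: dual_conv_funpow[OF \<beta> e] Lambda1_norm_unit_seq)
        finally show ?thesis by (simp add: pos_le_divide_eq)
      qed
      then show ?thesis using \<open>M > 0\<close> by (intro exI[of _ "M / weight \<alpha> p 0"]) auto
    qed
    then show "\<exists>q\<ge>1. \<forall>k\<ge>1. \<exists>L>0. \<forall>n. norm (conv_pow \<beta> k n) \<le> L * weight \<alpha> q n"
      using q by blast
  next
    assume decay: "\<forall>p\<ge>1::nat. \<exists>q\<ge>1. \<forall>k\<ge>1. \<exists>L>0. \<forall>n.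
      norm (conv_pow \<beta> k n) \<le> L * weight \<alpha> q n"
    have "\<exists>r\<ge>1. \<forall>k\<ge>1. \<exists>M>0. \<forall>x\<in>Lambda1 \<alpha>.
        Lambda1_norm \<alpha> p ((dual_conv \<beta> ^^ k) x) \<le> M * Lambda1_norm \<alpha> r x" if p: "p \<ge> 1" for p
    proof -
      obtain q where q: "q \<ge> 1"
        and L: "\<And>k. k \<ge> 1 \<Longrightarrow> \<exists>L>0. \<forall>n. norm (conv_pow \<beta> k n) \<le> L * weight \<alpha> q n"
        using decay p by blast
      obtain r C where r: "r \<ge> 1" and C: "C > 0"
        and bound: "\<And>(\<gamma> :: nat \<Rightarrow> 'a) L x. L > 0 \<Longrightarrow> \<forall>n. norm (\<gamma> n) \<le> L * weight \<alpha> q n \<Longrightarrow>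
          x \<in> Lambda1 \<alpha> \<Longrightarrow> Lambda1_norm \<alpha> p (dual_conv \<gamma> x) \<le> L * C * Lambda1_norm \<alpha> r x"
        using dual_conv_bounded[OF p q, where ?'a = 'a] by blast
      have "\<exists>M>0. \<forall>x\<in>Lambda1 \<alpha>.
          Lambda1_norm \<alpha> p ((dual_conv \<beta> ^^ k) x) \<le> M * Lambda1_norm \<alpha> r x" if k: "k \<ge> 1" for k
      proof -
        obtain L where L: "L > 0" "\<forall>n. norm (conv_pow \<beta> k n) \<le> L * weight \<alpha> q n"
          using L[OF k] by blast
        then show ?thesis
          using C bound[OF L] by (intro exI[of _ "L * C"]) (auto simp: dual_conv_funpow[OF \<beta>])
      qed
      then show ?thesis using r by blast
    qed
    then show ?top
      using dual_conv_continuous[OF \<beta>] by (simp add: topologizable_def)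
  qed
qed

end
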